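(* For every integer $r \geq 6$, the crossing number of the $r$-dimensional wrapped butterfly network $WB(r)$ satisfies $$Cr(WB(r)) \leq \frac{7}{8}\,4^{r} - (3r-4)\,2^{r}.$$
   Context: Butterfly network. For $r\ge 1$, the $r$-dimensional butterfly network $BF(r)$ is the graph whose vertices are the pairs $[w,i]$, where $i$ is an integer with $0\le i\le r$ (the level) and $w$ is an $r$-bit binary string (the row), with bits indexed by $0,1,\dots,r-1$. Two vertices $[w,i]$ and $[w',i']$ are joined by an edge if and only if $i'=i+1$ (up to exchanging the two vertices) and either $w=w'$, or $w$ and $w'$ differ in precisely the $i$-th bit. Thus $BF(r)$ has $(r+1)2^r$ vertices and $r2^{r+1}$ edges. Wrapped butterfly network. The $r$-dimensional wrapped butterfly network $WB(r)$ is the graph obtained from $BF(r)$ by merging, for each row $w$, the level-$0$ vertex $[w,0]$ with the level-$r$ vertex $[w,r]$. Thus $WB(r)$ has $r$ levels $0,1,\dots,r-1$, with $2^r$ vertices on each level; equivalently, $[w,i]$ is adjacent to $[w',(i+1) \bmod r]$ exactly when $w'=w$ or $w'$ differs from $w$ in precisely the $i$-th bit. Crossing number. A drawing of a simple graph $G$ in the plane (vertices are distinct points, edges are simple arcs joining their endpoints and not passing through other vertices) is good if no edge crosses itself, no two adjacent edges cross each other, no two edges cross more than once, and no three edges cross in a common point. The crossing number $Cr(G)$ is the minimum number of edge crossings over all good drawings of $G$ in the plane. *)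

theory Defs
  imports "HOL-Analysis.Analysis"
begin

text \<open>A simple graph is a vertex set together with a set of two-element edges. A vertex
  \<open>(w, i)\<close> consists of the row \<open>w\<close>, whose bits are \<open>w ! 0, \<dots>, w ! (r - 1)\<close>, and the
  level \<open>i\<close>.\<close>

definition bf_vertices :: "nat \<Rightarrow> (bool list \<times> nat) set" where
  "bf_vertices r = {(w, i). length w = r \<and> i \<le> r}"

definition bf_edges :: "nat \<Rightarrow> (bool list \<times> nat) set set" where
  "bf_edges r = {{(w, i), (w', i + 1)} | w w' i.
     length w = r \<and> length w' = r \<and> i < r \<and>
     (w = w' \<or> {j. j < r \<and> w ! j \<noteq> w' ! j} = {i})}"

definition wb_merge :: "nat \<Rightarrow> bool list \<times> nat \<Rightarrow> bool list \<times> nat" where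
  "wb_merge r = (\<lambda>(w, i). (w, if i = r then 0 else i))"

text \<open>For \<open>r \<le> 2\<close> the merging creates loops or parallel edges, which this rendering as a set of
  vertex sets collapses; for \<open>r \<ge> 3\<close> the result is a simple graph.\<close>

definition wb_vertices :: "nat \<Rightarrow> (bool list \<times> nat) set" where
  "wb_vertices r = wb_merge r ` bf_vertices r"

definition wb_edges :: "nat \<Rightarrow> (bool list \<times> nat) set set" where
  "wb_edges r = (\<lambda>e. wb_merge r ` e) ` bf_edges r"

lemma wb_vertices_eq:
  assumes "r \<ge> 1"
  shows "wb_vertices r = {(w, i). length w = r \<and> i < r}"
proof
  show "wb_vertices r \<subseteq> {(w, i). length w = r \<and> i < r}"
    using assms by (auto simp: wb_vertices_def bf_vertices_def wb_merge_def)
  show "{(w, i). length w = r \<and> i < r} \<subseteq> wb_vertices r"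
  proof clarify
    fix w :: "bool list" and i assume "r = length w" "i < length w"
    then show "(w, i) \<in> wb_vertices (length w)"
      unfolding wb_vertices_def
      by (intro image_eqI[of _ _ "(w, i)"]) (auto simp: bf_vertices_def wb_merge_def)
  qed
qed

lemma wb_edges_eq:
  "wb_edges r = {{(w, i), (w', (i + 1) mod r)} | w w' i.
     length w = r \<and> length w' = r \<and> i < r \<and>
     (w = w' \<or> {j. j < r \<and> w ! j \<noteq> w' ! j} = {i})}"
proof -
  have m: "wb_merge r ` {(w, i), (w', i + 1)} = {(w, i), (w', (i + 1) mod r)}"
    if "i < r" for w w' :: "bool list" and i
    using that by (cases "i + 1 = r") (auto simp: wb_merge_def)
  show ?thesis (is "_ = ?R")
  proof (intro equalityI subsetI)
    fix e assume "e \<in> wb_edges r"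
    then obtain w w' i where "e = wb_merge r ` {(w, i), (w', i + 1)}"
      "length w = r" "length w' = r" "i < r" "w = w' \<or> {j. j < r \<and> w ! j \<noteq> w' ! j} = {i}"
      unfolding wb_edges_def bf_edges_def by blast
    with m[of i w w'] show "e \<in> ?R" by blast
  next
    fix e assume "e \<in> ?R"
    then obtain w w' i where *: "e = {(w, i), (w', (i + 1) mod r)}"
      "length w = r" "length w' = r" "i < r" "w = w' \<or> {j. j < r \<and> w ! j \<noteq> w' ! j} = {i}"
      by blast
    then have "{(w, i), (w', i + 1)} \<in> bf_edges r"
      unfolding bf_edges_def by blast
    moreover have "e = wb_merge r ` {(w, i), (w', i + 1)}"
      using * m[of i w w'] by (simp only:)
    ultimately show "e \<in> wb_edges r"
      unfolding wb_edges_def by (rule rev_image_eqI)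
  qed
qed

lemma finite_wb_vertices: "finite (wb_vertices r)"
proof -
  have "bf_vertices r = {w. length w = r} \<times> {..r}"
    by (auto simp: bf_vertices_def)
  moreover have "finite {w :: bool list. length w = r}"
    using finite_lists_length_eq[of "UNIV :: bool set" r] by simp
  ultimately show ?thesis
    by (simp add: wb_vertices_def)
qed

lemma wb_edges_simple:
  assumes "r \<ge> 2" "e \<in> wb_edges r"
  shows "e \<subseteq> wb_vertices r" "card e = 2"
proof -
  obtain w w' i where e: "e = {(w, i), (w', (i + 1) mod r)}"
    "length w = r" "length w' = r" "i < r"
    using assms(2) unfolding wb_edges_eq by blast
  show "e \<subseteq> wb_vertices r"
    using e assms(1) by (auto simp: wb_vertices_eq)
  have "i \<noteq> (i + 1) mod r"
    using e(4) assms(1) by (cases "i + 1 = r") auto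
  then show "card e = 2"
    by (simp add: e(1))
qed

text \<open>The plane is \<open>complex\<close>. A drawing sends each vertex \<open>v\<close> to the point \<open>p v\<close> and each edge
  \<open>e\<close> to the simple arc \<open>\<gamma> e\<close>; the direction in which the arc is traversed is irrelevant.
  Injectivity of arcs already expresses that no edge crosses itself.\<close>

definition is_drawing ::
  "'a set \<Rightarrow> 'a set set \<Rightarrow> ('a \<Rightarrow> complex) \<Rightarrow> ('a set \<Rightarrow> real \<Rightarrow> complex) \<Rightarrow> bool" where
  "is_drawing V E p \<gamma> \<longleftrightarrow>
     inj_on p V \<and>
     (\<forall>e\<in>E. arc (\<gamma> e) \<and> {pathstart (\<gamma> e), pathfinish (\<gamma> e)} = p ` e \<and>
             path_image (\<gamma> e) \<inter> p ` V = p ` e)"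

definition arc_interior :: "(real \<Rightarrow> complex) \<Rightarrow> complex set" where
  "arc_interior g = path_image g - {pathstart g, pathfinish g}"

text \<open>Every common interior point of two edges is a crossing, so points where two edges merely
  touch are counted (and subject to the conditions on good drawings) as well.\<close>

definition crossings :: "('a set \<Rightarrow> real \<Rightarrow> complex) \<Rightarrow> 'a set \<Rightarrow> 'a set \<Rightarrow> complex set" where
  "crossings \<gamma> e f = arc_interior (\<gamma> e) \<inter> arc_interior (\<gamma> f)"

definition good_drawing ::
  "'a set \<Rightarrow> 'a set set \<Rightarrow> ('a \<Rightarrow> complex) \<Rightarrow> ('a set \<Rightarrow> real \<Rightarrow> complex) \<Rightarrow> bool" where
  "good_drawing V E p \<gamma> \<longleftrightarrow>
     is_drawing V E p \<gamma> \<and>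
     (\<forall>e\<in>E. \<forall>f\<in>E. e \<noteq> f \<and> e \<inter> f \<noteq> {} \<longrightarrow> crossings \<gamma> e f = {}) \<and>
     (\<forall>e\<in>E. \<forall>f\<in>E. e \<noteq> f \<longrightarrow> (\<forall>x\<in>crossings \<gamma> e f. \<forall>y\<in>crossings \<gamma> e f. x = y)) \<and>
     (\<forall>e\<in>E. \<forall>f\<in>E. \<forall>g\<in>E. e \<noteq> f \<and> e \<noteq> g \<and> f \<noteq> g \<longrightarrow>
        crossings \<gamma> e f \<inter> arc_interior (\<gamma> g) = {})"

definition crossing_points :: "'a set set \<Rightarrow> ('a set \<Rightarrow> real \<Rightarrow> complex) \<Rightarrow> complex set" where
  "crossing_points E \<gamma> = (\<Union>e\<in>E. \<Union>f\<in>E - {e}. crossings \<gamma> e f)"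

text \<open>In a good drawing of a finite graph \<open>crossing_points\<close> is finite, so that \<open>card\<close> is the true
  number of crossings; since no three edges cross in a common point, each crossing point belongs to
  exactly one pair of edges.\<close>

lemma finite_crossing_points:
  assumes "finite E" "good_drawing V E p \<gamma>"
  shows "finite (crossing_points E \<gamma>)"
  unfolding crossing_points_def
proof (intro finite_UN_I)
  fix e f assume "e \<in> E" "f \<in> E - {e}"
  then have "\<forall>x\<in>crossings \<gamma> e f. \<forall>y\<in>crossings \<gamma> e f. x = y"
    using assms(2) unfolding good_drawing_def by blast
  then have "crossings \<gamma> e f \<subseteq> {SOME x. x \<in> crossings \<gamma> e f}"
    by (metis singletonI someI subsetI)
  then show "finite (crossings \<gamma> e f)"
    by (rule finite_subset) simp
qed (use assms(1) in auto)

definition crossing_number :: "'a set \<Rightarrow> 'a set set \<Rightarrow> nat" where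
  "crossing_number V E =
     (LEAST n. \<exists>p \<gamma>. good_drawing V E p \<gamma> \<and> card (crossing_points E \<gamma>) = n)"

end

theory Submission
  imports Defs "HOL-Library.Nat_Bijection"
begin

text \<open>All vertices are placed on a line and all edges are semicircles above or below it. Row \<open>w\<close>
  occupies \<open>r\<close> consecutive places; the rows appear in reflected Gray code order, in which arcs for
  the same bit at different rows are nested or disjoint, and every second row is itself reversed.
  Edges within a row join neighbours, except for one closing edge per row. The arcs for bit \<open>k\<close> go
  above the line iff \<open>k\<close> is even. Two arcs cross only if they are on the same side and their ends
  interleave, which yields at most \<open>(r - 2) 2 ^ r\<close> crossings with closing edges, \<open>r 2 ^ (r - 1)\<close>
  among arcs for the same bit, \<open>2 ^ (r + j + 1)\<close> between bits \<open>0 < j < k\<close> of equal parity, and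
  \<open>2 ^ r\<close> between bit \<open>0\<close> and all other bits. The sum is about \<open>2 / 3 * 4 ^ r\<close>. Placing the vertices
  at the points \<open>2 ^ 2 ^ n\<close> excludes triple crossings.\<close>

section \<open>Two-page drawings\<close>

text \<open>The parameter runs linearly along the real axis instead of along the angle, so that
  injectivity is immediate. With real part \<open>x\<close> the height is the square root of
  \<open>(x - a) * (b - x)\<close>, which is the circle with diameter from \<open>a\<close> to
  \<open>b\<close>.\<close>

definition semicircle :: "bool \<Rightarrow> real \<Rightarrow> real \<Rightarrow> real \<Rightarrow> complex" where
  "semicircle up a b t =
     Complex (a + t * (b - a)) ((if up then 1 else - 1) * ((b - a) * sqrt (t * (1 - t))))"

lemma semicircle_ends [simp]:
  "pathstart (semicircle up a b) = complex_of_real a"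
  "pathfinish (semicircle up a b) = complex_of_real b"
  by (auto simp: semicircle_def pathstart_def pathfinish_def complex_eq_iff)

lemma arc_semicircle:
  assumes "a < b"
  shows "arc (semicircle up a b)"
proof -
  have "continuous_on {0..1} (semicircle up a b)"
    unfolding semicircle_def Complex_eq by (intro continuous_intros)
  moreover have "inj_on (semicircle up a b) {0..1}"
    using assms by (auto simp: inj_on_def semicircle_def)
  ultimately show ?thesis
    by (simp add: arc_def path_def)
qed

lemma path_image_semicircle:
  assumes "a < b"
  shows "path_image (semicircle up a b) =
    {z. a \<le> Re z \<and> Re z \<le> b \<and>
        Im z = (if up then 1 else - 1) * sqrt ((Re z - a) * (b - Re z))}" (is "_ = ?R")
proof
  have s: "sqrt ((t * (b - a)) * (b - (a + t * (b - a)))) = (b - a) * sqrt (t * (1 - t))" for t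
  proof -
    have "(t * (b - a)) * (b - (a + t * (b - a))) = (b - a)\<^sup>2 * (t * (1 - t))"
      by (simp add: algebra_simps power2_eq_square)
    moreover have "sqrt ((b - a)\<^sup>2 * (t * (1 - t))) = (b - a) * sqrt (t * (1 - t))"
      unfolding real_sqrt_mult[of "(b - a)\<^sup>2"] using assms by simp
    ultimately show ?thesis
      by (simp only:)
  qed
  show "path_image (semicircle up a b) \<subseteq> ?R"
  proof
    fix z assume "z \<in> path_image (semicircle up a b)"
    then obtain t where t: "0 \<le> t" "t \<le> 1" "z = semicircle up a b t"
      by (auto simp: path_image_def)
    moreover have "0 \<le> (1 - t) * (b - a)"
      using assms t by (intro mult_nonneg_nonneg) auto
    then have "a + t * (b - a) \<le> b"
      by (simp add: left_diff_distrib)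
    ultimately show "z \<in> ?R"
      using assms s[of t] by (simp add: semicircle_def)
  qed
  show "?R \<subseteq> path_image (semicircle up a b)"
  proof
    fix z assume z: "z \<in> ?R"
    define t where "t = (Re z - a) / (b - a)"
    have t: "t * (b - a) = Re z - a"
      using assms by (simp add: t_def)
    have "0 \<le> t" "t \<le> 1"
      using assms z by (auto simp: t_def)
    moreover have "z = semicircle up a b t"
      using z s[of t] by (simp add: semicircle_def complex_eq_iff t)
    ultimately show "z \<in> path_image (semicircle up a b)"
      by (auto simp: path_image_def)
  qed
qed

lemma arc_interior_semicircle:
  assumes "a < b"
  shows "arc_interior (semicircle up a b) =
    {z. a < Re z \<and> Re z < b \<and>
        Im z = (if up then 1 else - 1) * sqrt ((Re z - a) * (b - Re z))}"
  unfolding arc_interior_def path_image_semicircle[OF assms]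
  using assms by (auto simp: complex_eq_iff)

text \<open>At a common point the two products \<open>(x - a) * (b - x)\<close> and
  \<open>(x - c) * (d - x)\<close> agree. If one interval contained the other, both factors would
  compare the same way and one product would be larger, so the intervals interleave. Cancelling the
  squares leaves the radical axis of the two circles, a linear equation in
  \<open>Re z\<close>.\<close>

lemma semicircles_meet:
  assumes "a < b" "c < d" "(a, b) \<noteq> (c, d)"
    "z \<in> arc_interior (semicircle up a b)" "z \<in> arc_interior (semicircle up' c d)"
  shows "up = up'" "a < c \<and> c < b \<and> b < d \<or> c < a \<and> a < d \<and> d < b"
    "(a + b) * Re z - a * b = (c + d) * Re z - c * d"
proof -
  define x where "x = Re z"
  have x: "a < x" "x < b" "c < x" "x < d"
    and im: "Im z = (if up then 1 else - 1) * sqrt ((x - a) * (b - x))"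
      "Im z = (if up' then 1 else - 1) * sqrt ((x - c) * (d - x))"
    using assms by (auto simp: arc_interior_semicircle x_def)
  have pos: "(x - a) * (b - x) > 0" "(x - c) * (d - x) > 0"
    using x by simp_all
  then have "sqrt ((x - a) * (b - x)) > 0" "sqrt ((x - c) * (d - x)) > 0"
    by (simp_all only: real_sqrt_gt_0_iff)
  with im show "up = up'"
    by (cases up; cases up'; simp only: if_True if_False; linarith)
  with im have "sqrt ((x - a) * (b - x)) = sqrt ((x - c) * (d - x))"
    by (cases up) simp_all
  then have eq: "(x - a) * (b - x) = (x - c) * (d - x)"
    by simp
  then show "(a + b) * Re z - a * b = (c + d) * Re z - c * d"
    by (simp add: x_def algebra_simps)
  have "a \<noteq> c"
  proof
    assume "a = c"
    with eq x have "b = d" by simp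
    with \<open>a = c\<close> assms(3) show False by simp
  qed
  then consider "a < c" | "c < a" by linarith
  then show "a < c \<and> c < b \<and> b < d \<or> c < a \<and> a < d \<and> d < b"
  proof cases
    case 1
    have "b < d"
    proof (rule ccontr)
      assume "\<not> b < d"
      then have "(x - c) * (d - x) < (x - a) * (b - x)"
        using 1 x by (intro mult_less_le_imp_less) auto
      with eq show False by simp
    qed
    with 1 x show ?thesis by linarith
  next
    case 2
    have "d < b"
    proof (rule ccontr)
      assume "\<not> d < b"
      then have "(x - a) * (b - x) < (x - c) * (d - x)"
        using 2 x by (intro mult_less_le_imp_less) auto
      with eq show False by simp
    qed
    with 2 x show ?thesis by linarith
  qed
qed

section \<open>Positions that exclude triple crossings\<close>

text \<open>Doubly exponential, so that a product of values at distinct indices is \<open>2\<close>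
  to the power of the \<open>set_encode\<close> of the index set: monomials can be read as
  sets.\<close>

definition spine :: "nat \<Rightarrow> nat" where
  "spine n = 2 ^ 2 ^ n"

lemma spine_less_iff [simp]: "spine m < spine n \<longleftrightarrow> m < n"
  by (simp add: spine_def)

lemma spine_eq_iff [simp]: "spine m = spine n \<longleftrightarrow> m = n"
  by (simp add: spine_def)

text \<open>Both sides are sums of powers of two with pairwise distinct exponents, so they differ by
  uniqueness of binary expansions, which is here the injectivity of \<open>set_encode\<close>.\<close>

lemma spine_generic:
  assumes d: "distinct [a1, b1, a2, b2, a3, b3]"
  shows "(spine a1 + spine b1) * (spine a2 * spine b2)
       + (spine a2 + spine b2) * (spine a3 * spine b3)
       + (spine a3 + spine b3) * (spine a1 * spine b1)
       \<noteq> (spine a1 + spine b1) * (spine a3 * spine b3)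
       + (spine a2 + spine b2) * (spine a1 * spine b1)
       + (spine a3 + spine b3) * (spine a2 * spine b2)" (is "?L \<noteq> ?R")
proof -
  \<comment> \<open>The six monomials of each expanded side, each given by its three
    indices.\<close>
  let ?A = "[{a1, a2, b2}, {b1, a2, b2}, {a2, a3, b3}, {b2, a3, b3}, {a3, a1, b1}, {b3, a1, b1}]"
  let ?B = "[{a1, a3, b3}, {b1, a3, b3}, {a2, a1, b1}, {b2, a1, b1}, {a3, a2, b2}, {b3, a2, b2}]"
  have mono: "spine a * (spine b * spine c) = 2 ^ set_encode {a, b, c}"
    if "a \<noteq> b" "a \<noteq> c" "b \<noteq> c" for a b c
    using that by (simp add: spine_def power_add)
  have code: "set_encode (set_encode ` set Xs) = (\<Sum>X\<leftarrow>Xs. 2 ^ set_encode X)"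
    if "distinct Xs" "\<forall>X\<in>set Xs. finite X" for Xs
  proof -
    have "inj_on set_encode (set Xs)"
      using that(2) inj_on_set_encode by (auto intro: inj_on_subset)
    then show ?thesis
      using that(1) by (simp add: fun_cong[OF set_encode_def, of "set_encode ` set Xs"] sum.reindex sum_list_distinct_conv_sum_set)
  qed
  have dA: "distinct ?A" and dB: "distinct ?B"
    using d by (auto simp: set_eq_iff)
  have "?L = (\<Sum>X\<leftarrow>?A. 2 ^ set_encode X)" "?R = (\<Sum>X\<leftarrow>?B. 2 ^ set_encode X)"
    using d by (auto simp: distrib_right mono simp del: set_encode_insert)
  then have "?L = set_encode (set_encode ` set ?A)" "?R = set_encode (set_encode ` set ?B)"
    using code[OF dA] code[OF dB] by (simp_all only: list.set finite.intros ball_simps simp_thms)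
  moreover have "set_encode (set_encode ` set ?A) \<noteq> set_encode (set_encode ` set ?B)"
  proof
    assume "set_encode (set_encode ` set ?A) = set_encode (set_encode ` set ?B)"
    then have "set_encode ` set ?A = set_encode ` set ?B"
      by (simp add: set_encode_eq)
    \<comment> \<open>One monomial of the left side that is missing on the right suffices: no set in
      \<open>?B\<close> contains \<open>a1\<close>, \<open>a2\<close> and \<open>b2\<close>
      together.\<close>
    then have "set_encode {a1, a2, b2} \<in> set_encode ` set ?B"
      by (metis imageI list.set_intros(1))
    then have "{a1, a2, b2} \<in> set ?B"
      by (auto simp: set_encode_eq simp del: set_encode_insert)
    then have "\<exists>X\<in>set ?B. a1 \<in> X \<and> a2 \<in> X \<and> b2 \<in> X"
      by (rule rev_bexI) simp
    then show False
      using d by auto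
  qed
  ultimately show ?thesis by simp
qed

section \<open>From interleaved edges to the crossing number\<close>

text \<open>Oriented: the leftmost of the four ends belongs to \<open>e\<close>, so crossing edges
  are interleaved in one of the two orders.\<close>

definition interleaved :: "('a \<Rightarrow> nat) \<Rightarrow> 'a set \<Rightarrow> 'a set \<Rightarrow> bool" where
  "interleaved x e f \<longleftrightarrow>
     (\<exists>u\<in>e. \<exists>v\<in>f. \<exists>u'\<in>e. \<exists>v'\<in>f. x u < x v \<and> x v < x u' \<and> x u' < x v')"

text \<open>The semicircles over the \<open>spine\<close> positions form a good drawing, in which
  two edges on the same page cross at most once and only if interleaved. Since \<open>Y\<close> need
  contain a crossing pair in one order only, its cardinality bounds the number of crossing
  points.\<close>

lemma crossing_number_two_page:
  fixes x :: "'a \<Rightarrow> nat" and page :: "'a set \<Rightarrow> bool"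
  assumes inj: "inj_on x V"
    and edge: "\<And>e. e \<in> E \<Longrightarrow> e \<subseteq> V \<and> card e = 2"
    and "finite Y"
    and Y: "\<And>e f. e \<in> E \<Longrightarrow> f \<in> E \<Longrightarrow> page e = page f \<Longrightarrow> interleaved x e f
              \<Longrightarrow> (e, f) \<in> Y \<or> (f, e) \<in> Y"
  shows "crossing_number V E \<le> card Y"
proof -
  define p where "p = (\<lambda>v. complex_of_real (real (spine (x v))))"
  define lo where "lo = (\<lambda>e. Min (x ` e))"
  define hi where "hi = (\<lambda>e. Max (x ` e))"
  define \<gamma> where "\<gamma> = (\<lambda>e. semicircle (page e) (real (spine (lo e))) (real (spine (hi e))))"
  have ends: "lo e < hi e \<and> x ` e = {lo e, hi e}" if e: "e \<in> E" for e
  proof -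
    obtain u v where uv: "e = {u, v}" "u \<noteq> v"
      using edge[OF e] by (meson card_2_iff)
    then have "x u \<noteq> x v"
      using edge[OF e] inj by (auto simp: inj_on_def)
    then show ?thesis
      by (auto simp: uv lo_def hi_def min_def max_def)
  qed
  have lt: "real (spine (lo e)) < real (spine (hi e))" if "e \<in> E" for e
    using ends[OF that] by simp
  have p_eq: "p u = p v \<longleftrightarrow> x u = x v" for u v
    by (simp add: p_def)
  have ends_eq: "e = f" if ef: "e \<in> E" "f \<in> E" and "lo e = lo f" "hi e = hi f" for e f
  proof -
    have "x ` e = x ` f"
      using ends[of e] ends[of f] that by simp
    then show ?thesis
      using inj edge[OF ef(1)] edge[OF ef(2)] by (simp add: inj_on_image_eq_iff)
  qed
  have meet: "page e = page f \<and>
      (lo e < lo f \<and> lo f < hi e \<and> hi e < hi f \<or> lo f < lo e \<and> lo e < hi f \<and> hi f < hi e) \<and>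
      (real (spine (lo e)) + real (spine (hi e))) * Re z - real (spine (lo e)) * real (spine (hi e))
      = (real (spine (lo f)) + real (spine (hi f))) * Re z - real (spine (lo f)) * real (spine (hi f))"
    if "e \<in> E" "f \<in> E" "e \<noteq> f" "z \<in> crossings \<gamma> e f" for e f z
  proof -
    have "(real (spine (lo e)), real (spine (hi e))) \<noteq> (real (spine (lo f)), real (spine (hi f)))"
      using ends_eq that by auto
    with semicircles_meet[OF lt lt this, of z "page e" "page f"] that show ?thesis
      by (simp add: crossings_def \<gamma>_def)
  qed
  have inter: "page e = page f \<and> (interleaved x e f \<or> interleaved x f e)"
    if "e \<in> E" "f \<in> E" "e \<noteq> f" "z \<in> crossings \<gamma> e f" for e f z
  proof -
    have "lo e \<in> x ` e" "hi e \<in> x ` e" "lo f \<in> x ` f" "hi f \<in> x ` f"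
      using ends[OF that(1)] ends[OF that(2)] by simp_all
    then obtain a b c d where "a \<in> e" "b \<in> e" "c \<in> f" "d \<in> f"
      "lo e = x a" "hi e = x b" "lo f = x c" "hi f = x d"
      by (elim imageE) blast
    moreover have "page e = page f"
      "x a < x c \<and> x c < x b \<and> x b < x d \<or> x c < x a \<and> x a < x d \<and> x d < x b"
      using meet[OF that] calculation by simp_all
    ultimately show ?thesis
      unfolding interleaved_def by blast
  qed
  have drawing: "is_drawing V E p \<gamma>"
    unfolding is_drawing_def
  proof (intro conjI ballI)
    show "inj_on p V"
      using inj by (auto simp: inj_on_def p_eq)
    fix e assume e: "e \<in> E"
    show "arc (\<gamma> e)"
      unfolding \<gamma>_def by (rule arc_semicircle[OF lt[OF e]])
    have pe: "p ` e = (\<lambda>n. complex_of_real (real (spine n))) ` x ` e"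
      by (simp add: p_def image_image)
    then show st: "{pathstart (\<gamma> e), pathfinish (\<gamma> e)} = p ` e"
      using ends[OF e] by (simp add: \<gamma>_def)
    have "p v \<in> p ` e" if "v \<in> V" "p v \<in> path_image (\<gamma> e)" for v
    proof -
      have "p v \<notin> arc_interior (\<gamma> e)"
      proof
        assume "p v \<in> arc_interior (\<gamma> e)"
        then show False
          unfolding \<gamma>_def arc_interior_semicircle[OF lt[OF e]] by (auto simp: p_def split: if_splits)
      qed
      with that(2) st show ?thesis
        by (auto simp: arc_interior_def)
    qed
    moreover have "p ` e \<subseteq> path_image (\<gamma> e)"
      unfolding st[symmetric] by (simp add: pathstart_in_path_image pathfinish_in_path_image)
    ultimately show "path_image (\<gamma> e) \<inter> p ` V = p ` e"
      using edge[OF e] by blast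
  qed
  have adjacent: "crossings \<gamma> e f = {}" if "e \<in> E" "f \<in> E" "e \<noteq> f" "e \<inter> f \<noteq> {}" for e f
  proof (rule ccontr)
    assume "crossings \<gamma> e f \<noteq> {}"
    then obtain z where "z \<in> crossings \<gamma> e f"
      by blast
    from meet[OF that(1-3) this] have "lo e \<noteq> lo f" "lo e \<noteq> hi f" "hi e \<noteq> lo f" "hi e \<noteq> hi f"
      by auto
    then have "x ` e \<inter> x ` f = {}"
      using ends[OF that(1)] ends[OF that(2)] by simp
    with that(4) show False
      by blast
  qed
  have once: "z = z'"
    if ef: "e \<in> E" "f \<in> E" "e \<noteq> f" and z: "z \<in> crossings \<gamma> e f" "z' \<in> crossings \<gamma> e f" for e f z z'
  proof -
    let ?a = "real (spine (lo e))" and ?b = "real (spine (hi e))"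
    let ?c = "real (spine (lo f))" and ?d = "real (spine (hi f))"
    \<comment> \<open>The difference of the radical axis equations at \<open>z\<close> and
      \<open>z'\<close>. Interleaving orders both pairs of ends the same way, so the first factor is
      not zero.\<close>
    have "((?a + ?b) - (?c + ?d)) * (Re z - Re z') = 0"
      using meet[OF ef z(1)] meet[OF ef z(2)] by algebra
    moreover have "?a + ?b \<noteq> ?c + ?d"
    proof -
      have "?a < ?c \<and> ?b < ?d \<or> ?c < ?a \<and> ?d < ?b"
        using meet[OF ef z(1)] by auto
      then show ?thesis by linarith
    qed
    ultimately have "Re z = Re z'"
      by simp
    then show ?thesis
      using z unfolding crossings_def \<gamma>_def arc_interior_semicircle[OF lt[OF ef(1)]]
      by (auto simp: complex_eq_iff)
  qed
  have no_triple: "crossings \<gamma> e f \<inter> arc_interior (\<gamma> g) = {}"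
    if efg: "e \<in> E" "f \<in> E" "g \<in> E" "e \<noteq> f" "e \<noteq> g" "f \<noteq> g" for e f g
  proof (rule ccontr)
    assume "crossings \<gamma> e f \<inter> arc_interior (\<gamma> g) \<noteq> {}"
    then obtain z where z: "z \<in> crossings \<gamma> e f" "z \<in> crossings \<gamma> e g" "z \<in> crossings \<gamma> f g"
      by (auto simp: crossings_def)
    note m = meet[OF efg(1,2,4) z(1)] meet[OF efg(1,3,5) z(2)] meet[OF efg(2,3,6) z(3)]
    let ?s = "\<lambda>e. real (spine (lo e)) + real (spine (hi e))"
    let ?p = "\<lambda>e. real (spine (lo e)) * real (spine (hi e))"
    have "distinct [lo e, hi e, lo f, hi f, lo g, hi g]"
      using m by auto
    note spine_generic[OF this]
    \<comment> \<open>At a common point of three arcs the value \<open>?s * Re z - ?p\<close> is the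
      same for all three edges, so the three points \<open>(?s, ?p)\<close> are collinear. This is
      their vanishing determinant, which \<open>spine_generic\<close> excludes.\<close>
    moreover have "?s e * ?p f + ?s f * ?p g + ?s g * ?p e = ?s e * ?p g + ?s f * ?p e + ?s g * ?p f"
      using m by algebra
    then have "real ((spine (lo e) + spine (hi e)) * (spine (lo f) * spine (hi f))
       + (spine (lo f) + spine (hi f)) * (spine (lo g) * spine (hi g))
       + (spine (lo g) + spine (hi g)) * (spine (lo e) * spine (hi e)))
       = real ((spine (lo e) + spine (hi e)) * (spine (lo g) * spine (hi g))
       + (spine (lo f) + spine (hi f)) * (spine (lo e) * spine (hi e))
       + (spine (lo g) + spine (hi g)) * (spine (lo f) * spine (hi f)))"
      by simp
    ultimately show False
      by (simp only: of_nat_eq_iff)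
  qed
  have good: "good_drawing V E p \<gamma>"
    unfolding good_drawing_def
    by (intro conjI ballI impI drawing; (elim conjE)?; rule adjacent once no_triple; assumption)
  \<comment> \<open>Each pair is sent to its only crossing point; the arbitrary value at pairs that
    do not cross is harmless for an upper bound.\<close>
  have "crossing_points E \<gamma> \<subseteq> (\<lambda>(e, f). THE z. z \<in> crossings \<gamma> e f) ` Y"
  proof
    fix z assume "z \<in> crossing_points E \<gamma>"
    then obtain e f where ef: "e \<in> E" "f \<in> E" "e \<noteq> f" and z: "z \<in> crossings \<gamma> e f"
      by (auto simp: crossing_points_def)
    have "crossings \<gamma> e f = {z}"
      using once[OF ef z] z by blast
    moreover have "crossings \<gamma> f e = crossings \<gamma> e f"
      by (auto simp: crossings_def)
    moreover have "(e, f) \<in> Y \<or> (f, e) \<in> Y"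
      using inter[OF ef z] Y[of e f] Y[of f e] ef by auto
    ultimately show "z \<in> (\<lambda>(e, f). THE z. z \<in> crossings \<gamma> e f) ` Y"
      by (force intro: rev_image_eqI)
  qed
  then have "card (crossing_points E \<gamma>) \<le> card Y"
    using \<open>finite Y\<close> by (rule surj_card_le[rotated])
  moreover have "crossing_number V E \<le> card (crossing_points E \<gamma>)"
    unfolding crossing_number_def by (rule Least_le) (use good in blast)
  ultimately show ?thesis by simp
qed

section \<open>The layout of the wrapped butterfly\<close>

definition flip :: "nat \<Rightarrow> bool list \<Rightarrow> bool list" where
  "flip k w = w[k := \<not> w ! k]"

lemma length_flip [simp]: "length (flip k w) = length w"
  by (simp add: flip_def)

lemma flip_flip [simp]: "flip k (flip k w) = w"
  by (cases "k < length w") (simp_all add: flip_def list_update_beyond)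

lemma nth_flip: "k < length w \<Longrightarrow> flip k w ! i = (if i = k then \<not> w ! k else w ! i)"
  by (simp add: flip_def nth_list_update)

lemma drop_flip [simp]: "k < j \<Longrightarrow> drop j (flip k w) = drop j w"
  by (simp add: flip_def)

text \<open>The rank of a code word in the reflected Gray code, with the least significant bit at
  the head of the list: each binary digit is the code bit xor the next higher binary digit.\<close>

fun gray :: "bool list \<Rightarrow> nat" where
  "gray [] = 0"
| "gray (x # xs) = 2 * gray xs + (if x = odd (gray xs) then 0 else 1)"

lemma gray_eq_iff:
  assumes "length v = length w"
  shows "gray v = gray w \<longleftrightarrow> v = w"
  using assms
proof (induction v w rule: list_induct2)
  case (Cons x xs y ys)
  show ?case
  proof
    assume eq: "gray (x # xs) = gray (y # ys)"
    have half: "gray (z # zs) div 2 = gray zs" for z zs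
      by auto
    have "gray xs = gray ys"
      using half[of x xs] half[of y ys] unfolding eq by (rule trans[OF sym])
    then have "xs = ys"
      using Cons.IH by blast
    with eq show "x # xs = y # ys"
      by (simp split: if_splits)
  qed simp
qed simp

text \<open>Words that agree from bit \<open>k\<close> on thus fill a block of \<open>2 ^ k\<close>
  consecutive ranks, and \<open>gray (drop k w)\<close> is the number of that block.\<close>

lemma gray_drop: "gray (drop k w) = gray w div 2 ^ k"
proof (induction k arbitrary: w)
  case (Suc k)
  show ?case
  proof (cases w)
    case (Cons x xs)
    have "gray w div 2 = gray xs"
      by (auto simp: Cons)
    then show ?thesis
      using Suc[of xs] by (simp add: Cons div_mult2_eq)
  qed simp
qed simp

text \<open>Flipping bit \<open>k\<close> reflects the block of \<open>2 ^ Suc k\<close> ranks about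
  its centre. The right-hand side depends on the block only, which makes arcs for the same bit
  nested or disjoint.\<close>

lemma gray_flip:
  "k < length w \<Longrightarrow> gray (flip k w) + gray w + 1 = 2 * (2 ^ k * (2 * gray (drop (Suc k) w) + 1))"
proof (induction w arbitrary: k)
  case (Cons x xs)
  show ?case
  proof (cases k)
    case 0
    then show ?thesis by (simp add: flip_def)
  next
    case (Suc m)
    have IH: "gray (flip m xs) + gray xs + 1 = 2 * (2 ^ m * (2 * gray (drop (Suc m) xs) + 1))"
      using Cons Suc by simp
    then have "even (gray (flip m xs) + gray xs + 1)"
      by simp
    then have "odd (gray (flip m xs)) \<longleftrightarrow> even (gray xs)"
      by simp
    moreover have "flip k (x # xs) = x # flip m xs"
      by (simp add: flip_def Suc)
    ultimately have "gray (flip k (x # xs)) + gray (x # xs) + 1 = 2 * (gray (flip m xs) + gray xs + 1)"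
      by auto
    then show ?thesis
      unfolding IH by (simp add: Suc)
  qed
qed simp

lemma gray_less_flip:
  assumes "k < length w"
  shows "gray w < gray (flip k w) \<longleftrightarrow> even (gray (drop k w))"
    and "gray (flip k w) < gray w \<longleftrightarrow> odd (gray (drop k w))"
    and "even (gray (drop k (flip k w))) \<longleftrightarrow> odd (gray (drop k w))"
proof -
  \<comment> \<open>The first rank in the upper half of the block.\<close>
  define C where "C = 2 ^ k * (2 * gray (drop (Suc k) w) + 1)"
  have half: "gray v < C \<longleftrightarrow> even (gray (drop k v))" if v: "drop (Suc k) v = drop (Suc k) w" for v
  proof -
    have "gray (drop (Suc k) w) = gray (drop k v) div 2"
      unfolding v[symmetric] gray_drop by (simp add: div_mult2_eq mult.commute[of 2])
    then have "even (gray (drop k v)) \<longleftrightarrow> gray (drop k v) < 2 * gray (drop (Suc k) w) + 1"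
      by presburger
    also have "\<dots> \<longleftrightarrow> gray v < C"
      unfolding C_def gray_drop[of k v] by (simp add: less_mult_imp_div_less div_less_iff_less_mult mult.commute)
    finally show ?thesis ..
  qed
  have sum: "gray (flip k w) + gray w + 1 = 2 * C"
    unfolding C_def by (rule gray_flip[OF assms])
  show "gray w < gray (flip k w) \<longleftrightarrow> even (gray (drop k w))"
    "gray (flip k w) < gray w \<longleftrightarrow> odd (gray (drop k w))"
    "even (gray (drop k (flip k w))) \<longleftrightarrow> odd (gray (drop k w))"
    using sum half[of w] half[of "flip k w"] by auto
qed

section \<open>Places of the vertices on the line\<close>

definition place :: "nat \<Rightarrow> bool list \<times> nat \<Rightarrow> nat" where
  "place r = (\<lambda>(w, l). r * gray w + (if even (gray w) then r - 1 - l else l))"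

lemma place_less:
  assumes "gray w < gray v" "l < r"
  shows "place r (w, l) < place r (v, m)"
proof -
  have "r * gray w + r \<le> r * gray v"
    using assms(1) by (metis Suc_leI mult_Suc_right add.commute mult_le_mono2)
  then show ?thesis
    using assms(2) by (auto simp: place_def)
qed

lemma gray_le_of_place:
  assumes "place r (w, l) < place r (v, m)" "m < r"
  shows "gray w \<le> gray v"
  using place_less[of v w m r l] assms by (meson leI less_asym)

lemma inj_on_place: "inj_on (place r) {(w, l). length w = r \<and> l < r}"
proof (rule inj_onI, clarify)
  fix w l v m
  assume *: "length v = length w" "l < length w" "m < length w"
    "place (length w) (w, l) = place (length w) (v, m)"
  then have "gray w = gray v"
    using place_less[of w v l] place_less[of v w m] by (metis less_irrefl linorder_neqE_nat)
  with * show "w = v \<and> l = m"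
    by (auto simp: place_def gray_eq_iff split: if_splits)
qed

text \<open>A flip changes the parity of the rank and hence the direction of the row. Because of
  this reversal the reflection of the ranks extends to a reflection of the places, with the same
  centre for all levels.\<close>

lemma place_flip:
  assumes "k < length w" "l < r"
  shows "place r (flip k w, l) + place r (w, l) + 1 = r * (2 * (2 ^ k * (2 * gray (drop (Suc k) w) + 1)))"
proof -
  have e: "gray (flip k w) + gray w + 1 = 2 * (2 ^ k * (2 * gray (drop (Suc k) w) + 1))"
    by (rule gray_flip[OF assms(1)])
  then have "even (gray (flip k w) + gray w + 1)"
    by simp
  then have "place r (flip k w, l) + place r (w, l) + 1 = r * gray (flip k w) + r * gray w + r"
    using assms(2) by (auto simp: place_def)
  also have "\<dots> = r * (gray (flip k w) + gray w + 1)"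
    by (simp add: algebra_simps)
  finally show ?thesis
    unfolding e .
qed

section \<open>Edges of the wrapped butterfly\<close>

definition cross_level :: "nat \<Rightarrow> nat \<Rightarrow> bool \<Rightarrow> nat" where
  "cross_level r k s = (if s then (k + 1) mod r else k)"

lemma cross_level_less [simp]: "k < r \<Longrightarrow> cross_level r k s < r"
  by (simp add: cross_level_def)

text \<open>Every such edge has two descriptions, one from each end. They are exchanged by
  \<open>cross_edge_flip\<close>, so an argument may start from whichever row is convenient.\<close>

definition cross_edge :: "nat \<Rightarrow> nat \<Rightarrow> bool list \<Rightarrow> bool \<Rightarrow> (bool list \<times> nat) set" where
  "cross_edge r k w s = {(w, cross_level r k s), (flip k w, cross_level r k (\<not> s))}"

lemma cross_edge_flip: "cross_edge r k (flip k w) s = cross_edge r k w (\<not> s)"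
  by (auto simp: cross_edge_def)

lemma cross_edge_cases:
  assumes "y \<in> cross_edge r k w s" "length w = r"
  obtains v t where "cross_edge r k w s = cross_edge r k v t" "y = (v, cross_level r k t)" "length v = r"
proof -
  have "y = (w, cross_level r k s) \<or> y = (flip k w, cross_level r k (\<not> s))"
    using assms(1) by (simp add: cross_edge_def)
  then show thesis
    using that[of w s] that[of "flip k w" "\<not> s"] assms(2) by (elim disjE) (simp_all add: cross_edge_flip)
qed

lemma wb_edge_cases:
  assumes "e \<in> wb_edges r" "r > 0"
  obtains (row) w l where "e = {(w, l), (w, Suc l)}" "length w = r" "Suc l < r"
  | (closing) w where "e = {(w, 0), (w, r - 1)}" "length w = r"
  | (cross) k w where "e = cross_edge r k w False" "k < r" "length w = r"
proof -
  obtain w w' i where e: "e = {(w, i), (w', (i + 1) mod r)}" "length w = r" "length w' = r" "i < r"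
    "w = w' \<or> {j. j < r \<and> w ! j \<noteq> w' ! j} = {i}"
    using assms(1) unfolding wb_edges_eq by blast
  show thesis
  proof (cases "w = w'")
    case True
    show thesis
    proof (cases "Suc i = r")
      case True
      then have "i = r - 1" by simp
      then have "e = {(w, 0), (w, r - 1)}"
        using e \<open>w = w'\<close> assms(2) by (auto simp: insert_commute)
      with e closing show thesis by blast
    next
      case False
      with e \<open>w = w'\<close> show thesis
        using row[of w i] by simp
    qed
  next
    case False
    then have "{j. j < r \<and> w ! j \<noteq> w' ! j} = {i}"
      using e by blast
    then have "w' = flip i w"
      using e by (intro nth_equalityI) (auto simp: nth_flip)
    then show thesis
      using cross[of i w] e by (simp add: cross_edge_def cross_level_def)
  qed
qed

text \<open>Bit-\<open>k\<close> cross edges are drawn above the line iff \<open>k\<close> is even; all edges within a row above.\<close>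

definition upper :: "(bool list \<times> nat) set \<Rightarrow> bool" where
  "upper e \<longleftrightarrow> (\<forall>(v, l)\<in>e. \<forall>(w, m)\<in>e. \<forall>k<length v. v ! k \<noteq> w ! k \<longrightarrow> even k)"

lemma upper_row [simp]: "upper {(w, l), (w, m)}"
  by (simp add: upper_def)

lemma upper_cross_edge [simp]:
  assumes "k < length w"
  shows "upper (cross_edge r k w s) \<longleftrightarrow> even k"
proof -
  have "w ! i \<noteq> flip k w ! i \<longleftrightarrow> i = k" "flip k w ! i \<noteq> w ! i \<longleftrightarrow> i = k" for i
    using assms by (auto simp: nth_flip)
  then show ?thesis
    using assms by (simp add: upper_def cross_edge_def)
qed

section \<open>Classification of the crossing pairs\<close>

definition words :: "nat \<Rightarrow> bool list set" where
  "words n = {w. length w = n}"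

lemma card_words: "card (words n) = 2 ^ n" and finite_words [simp]: "finite (words n)"
  using card_lists_length_eq[of "UNIV :: bool set" n] finite_lists_length_eq[of "UNIV :: bool set" n]
  by (simp_all add: words_def)

text \<open>Here \<open>l\<close> is the level of a vertex under the closing edge. It lies on the
  cross edges for bits \<open>l\<close> and \<open>l - 1\<close>, of which only the one for the even
  bit is drawn above the line.\<close>

definition closing_pairs ::
  "nat \<Rightarrow> ((bool list \<times> nat) set \<times> (bool list \<times> nat) set) set" where
  "closing_pairs r = (\<lambda>(w, l). ({(w, 0), (w, r - 1)},
       if even l then cross_edge r l w False else cross_edge r (l - 1) w True))
     ` (words r \<times> {1..<r - 1})"

text \<open>The two cross edges between the same two rows; the parity condition selects the row of
  smaller rank, so that each pair arises from one word.\<close>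

definition same_bit_pairs ::
  "nat \<Rightarrow> ((bool list \<times> nat) set \<times> (bool list \<times> nat) set) set" where
  "same_bit_pairs r = (\<lambda>(k, w). (cross_edge r k w False, cross_edge r k w True))
     ` (SIGMA k:{..<r}. {w \<in> words r. even (gray (drop k w))})"

text \<open>The ends of an arc for bit \<open>k > j\<close> lie in different blocks of \<open>2 ^ (j + 1)\<close> rows, so it crosses
  an arc for bit \<open>j\<close> iff one of its ends lies between the ends of the latter. The half block of that
  end contains exactly one end of the bit-\<open>j\<close> arc; \<open>cover\<close> records these two ends.\<close>

definition cover :: "nat \<Rightarrow> nat \<Rightarrow> nat \<Rightarrow> (bool list \<times> bool \<times> bool list \<times> bool) set" where
  "cover r j k = {(w, s, v, t). length w = r \<and> length v = r \<and> drop j w = drop j v \<and>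
     (if even (gray (drop j w)) then place r (w, cross_level r j s) < place r (v, cross_level r k t)
      else place r (v, cross_level r k t) < place r (w, cross_level r j s))}"

definition cross_pairs ::
  "nat \<Rightarrow> ((bool list \<times> nat) set \<times> (bool list \<times> nat) set) set" where
  "cross_pairs r = (\<lambda>((k, j), w, s, v, t). (cross_edge r j w s, cross_edge r k v t))
     ` (SIGMA (k, j):(SIGMA k:{..<r}. {j. j < k \<and> even j = even k}). cover r j k)"

text \<open>The two ends occupy consecutive places.\<close>

lemma row_gap:
  assumes "u \<in> {(w, l), (w, Suc l)}" "u' \<in> {(w, l), (w, Suc l)}" "Suc l < r"
    "place r u < n" "n < place r u'"
  shows False
  using assms by (auto simp: place_def split: if_splits)

text \<open>Each row occupies an interval of places, and the edge joins the two extreme vertices of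
  row \<open>w\<close>.\<close>

lemma closing_gap:
  assumes "u \<in> {(w, 0), (w, r - 1)}" "u' \<in> {(w, 0), (w, r - 1)}" "length w = r"
    "place r u < place r (v, l)" "place r (v, l) < place r u'" "l < r" "length v = r"
  shows "v = w" "0 < l" "l < r - 1"
proof -
  have "gray w \<le> gray v" "gray v \<le> gray w"
    using assms gray_le_of_place[of r w 0 v l] gray_le_of_place[of r w "r - 1" v l]
      gray_le_of_place[of r v l w 0] gray_le_of_place[of r v l w "r - 1"] by auto
  then show v: "v = w"
    using assms by (simp add: gray_eq_iff[symmetric])
  show "0 < l" "l < r - 1"
    using assms unfolding v by (auto simp: place_def split: if_splits)
qed

lemma closing_crosses:
  assumes "u \<in> {(w, 0), (w, r - 1)}" "u' \<in> {(w, 0), (w, r - 1)}" "length w = r"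
    and "place r u < place r y" "place r y < place r u'"
    and y: "y \<in> cross_edge r k v t" "length v = r" and k: "k < r" "even k"
  shows "({(w, 0), (w, r - 1)}, cross_edge r k v t) \<in> closing_pairs r"
proof -
  obtain v' t' where v': "cross_edge r k v t = cross_edge r k v' t'" "y = (v', cross_level r k t')"
    "length v' = r"
    using cross_edge_cases[OF y] by metis
  define l where "l = cross_level r k t'"
  have l: "v' = w" "0 < l" "l < r - 1"
    using closing_gap[of u w r u' v' l] assms v' by (auto simp: l_def)
  have "cross_edge r k v' t' = (if even l then cross_edge r l w False else cross_edge r (l - 1) w True)"
  proof (cases t')
    case True
    \<comment> \<open>Wrapping around, for \<open>Suc k = r\<close>, would give level
      \<open>0\<close>, an end of the closing edge.\<close>
    have "l = Suc k"
      using l k True by (cases "Suc k = r") (auto simp: l_def cross_level_def)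
    with True l k show ?thesis by simp
  qed (use l k in \<open>simp add: l_def cross_level_def\<close>)
  with l v' assms(3) show ?thesis
    unfolding closing_pairs_def by (intro image_eqI[of _ _ "(w, l)"]) (auto simp: words_def)
qed

text \<open>The two ends of a cross edge for bit \<open>k\<close> lie in the same block of \<open>2 ^ Suc k\<close> rows.\<close>

lemma block_between:
  assumes "u \<in> cross_edge r k w s" "u' \<in> cross_edge r k w s" "length w = r" "k < r"
    "place r u < place r (v, l)" "place r (v, l) < place r u'" "l < r" "length v = r"
  shows "drop (Suc k) v = drop (Suc k) w"
proof -
  obtain a m a' m' where a: "u = (a, m)" "u' = (a', m')" "a \<in> {w, flip k w}" "a' \<in> {w, flip k w}" "m' < r"
    using assms(1-4) by (auto simp: cross_edge_def)
  then have "drop (Suc k) a = drop (Suc k) w" "drop (Suc k) a' = drop (Suc k) w"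
    by auto
  moreover have "gray a \<le> gray v" "gray v \<le> gray a'"
    using assms a gray_le_of_place by blast+
  then have "gray a div 2 ^ Suc k \<le> gray v div 2 ^ Suc k" "gray v div 2 ^ Suc k \<le> gray a' div 2 ^ Suc k"
    by (simp_all only: div_le_mono)
  ultimately have "gray (drop (Suc k) v) = gray (drop (Suc k) w)"
    unfolding gray_drop[symmetric] by simp
  then show ?thesis
    using assms by (simp add: gray_eq_iff)
qed

lemma cross_crosses:
  assumes u: "u \<in> cross_edge r j w s" "u' \<in> cross_edge r j w s" "length w = r"
    and "place r u < place r y" "place r y < place r u'"
    and y: "y \<in> cross_edge r k v t" "length v = r"
    and k: "j < k" "k < r" "even j = even k"
  shows "(cross_edge r j w s, cross_edge r k v t) \<in> cross_pairs r"
proof -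
  obtain v' t' where v': "cross_edge r k v t = cross_edge r k v' t'" "y = (v', cross_level r k t')"
    "length v' = r"
    using cross_edge_cases[OF y] by metis
  have "drop (Suc j) v' = drop (Suc j) w"
    using block_between[OF u] assms v' by auto
  moreover have "drop j v' = v' ! j # drop (Suc j) v'" "drop j w = w ! j # drop (Suc j) w"
    "drop j (flip j w) = flip j w ! j # drop (Suc j) (flip j w)"
    using Cons_nth_drop_Suc[of j v'] Cons_nth_drop_Suc[of j w] Cons_nth_drop_Suc[of j "flip j w"]
      k v' u by simp_all
  ultimately have "drop j v' = drop j w \<or> drop j v' = drop j (flip j w)"
    using k u by (auto simp: nth_flip)
  \<comment> \<open>Of the two descriptions of the bit-\<open>j\<close> edge, the one whose row lies
    in the same half block as \<open>v'\<close>.\<close>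
  then obtain w' s' where w': "cross_edge r j w s = cross_edge r j w' s'" "drop j w' = drop j v'" "length w' = r"
    using that[of w s] that[of "flip j w" "\<not> s"] u(3) by (auto simp: cross_edge_flip)
  have jr: "j < r" and jw: "j < length w'"
    using k w' by auto
  have "(w', s', v', t') \<in> cover r j k"
  proof (cases "even (gray (drop j w'))")
    \<comment> \<open>In the lower half block the chosen end is the left end of the arc, hence to
      the left of \<open>y\<close>; in the upper half it is the right end.\<close>
    case True
    then have "place r (w', cross_level r j s') < place r (flip j w', cross_level r j (\<not> s'))"
      using gray_less_flip(1)[OF jw] jr by (intro place_less) auto
    then have "place r (w', cross_level r j s') \<le> place r u"
      using u unfolding w' by (auto simp: cross_edge_def)
    with True assms v' w' show ?thesis
      by (simp add: cover_def)
  next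
    case False
    then have "place r (flip j w', cross_level r j (\<not> s')) < place r (w', cross_level r j s')"
      using gray_less_flip(2)[OF jw] jr by (intro place_less) auto
    then have "place r u' \<le> place r (w', cross_level r j s')"
      using u unfolding w' by (auto simp: cross_edge_def)
    with False assms v' w' show ?thesis
      by (simp add: cover_def)
  qed
  then show ?thesis
    unfolding cross_pairs_def using k w' v'
    by (intro image_eqI[of _ _ "((k, j), w', s', v', t')"]) auto
qed

lemma lower_end:
  assumes "k < r" "length w = r"
  obtains v t where "cross_edge r k w s = cross_edge r k v t" "length v = r" "even (gray (drop k v))"
proof (cases "even (gray (drop k w))")
  case True
  then show ?thesis using that[of w s] assms by simp
next
  case False
  then show ?thesis
    using that[of "flip k w" "\<not> s"] assms gray_less_flip(3)[of k w] by (simp add: cross_edge_flip)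
qed

text \<open>Interleaved arcs for the same bit share a block, and both are reflected about its
  centre. The ranks of the left ends and those of the right ends are ordered the same way but have
  equal sums, so both edges join the same two rows.\<close>

lemma same_bit_crosses:
  assumes il: "interleaved (place r) (cross_edge r k w s) (cross_edge r k v t)"
    and w: "length w = r" and v: "length v = r" and k: "k < r"
  shows "(cross_edge r k w s, cross_edge r k v t) \<in> same_bit_pairs r \<or>
         (cross_edge r k v t, cross_edge r k w s) \<in> same_bit_pairs r"
proof -
  obtain w' s' where w': "cross_edge r k w s = cross_edge r k w' s'" "length w' = r" "even (gray (drop k w'))"
    using lower_end[OF k w] by metis
  obtain v' t' where v': "cross_edge r k v t = cross_edge r k v' t'" "length v' = r" "even (gray (drop k v'))"
    using lower_end[OF k v] by metis
  have lt: "place r (w', cross_level r k s') < place r (flip k w', cross_level r k (\<not> s'))"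
    "place r (v', cross_level r k t') < place r (flip k v', cross_level r k (\<not> t'))"
    using gray_less_flip(1)[of k w'] gray_less_flip(1)[of k v'] w' v' k by (auto intro!: place_less)
  obtain a b a' b' where ab: "a \<in> cross_edge r k w' s'" "a' \<in> cross_edge r k w' s'"
    "b \<in> cross_edge r k v' t'" "b' \<in> cross_edge r k v' t'"
    "place r a < place r b" "place r b < place r a'" "place r a' < place r b'"
    using il unfolding interleaved_def w' v' by blast
  then have eqs: "a = (w', cross_level r k s')" "a' = (flip k w', cross_level r k (\<not> s'))"
    "b = (v', cross_level r k t')" "b' = (flip k v', cross_level r k (\<not> t'))"
    using lt unfolding cross_edge_def by fastforce+
  have "drop (Suc k) v' = drop (Suc k) w'"
    using block_between[OF ab(1,2) w'(2) k] ab eqs v' k by auto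
  then have "gray (flip k v') + gray v' = gray (flip k w') + gray w'"
    using gray_flip[of k v'] gray_flip[of k w'] v' w' k by simp
  moreover have "gray w' \<le> gray v'" "gray (flip k w') \<le> gray (flip k v')"
    using ab k unfolding eqs by (auto dest!: gray_le_of_place)
  ultimately have eq: "v' = w'"
    using w' v' by (simp add: gray_eq_iff[symmetric])
  have "s' \<noteq> t'"
    using ab eqs eq by (cases s'; cases t') auto
  moreover have "(cross_edge r k w' False, cross_edge r k w' True) \<in> same_bit_pairs r"
    unfolding same_bit_pairs_def using w' k
    by (intro image_eqI[of _ _ "(k, w')"]) (auto simp: words_def)
  ultimately show ?thesis
    unfolding w' v' eq by (cases s'; cases t') auto
qed

lemma interleaved_pairs:
  assumes r: "r > 0" and E: "e \<in> wb_edges r" "f \<in> wb_edges r"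
    and page: "upper e = upper f" and il: "interleaved (place r) e f"
  defines "Y \<equiv> closing_pairs r \<union> same_bit_pairs r \<union> cross_pairs r"
  shows "(e, f) \<in> Y \<or> (f, e) \<in> Y"
proof -
  \<comment> \<open>The end \<open>v\<close> of \<open>f\<close> lies between the ends of
    \<open>e\<close>, and the end \<open>u'\<close> of \<open>e\<close> between those of
    \<open>f\<close>, so either edge can serve as the outer one.\<close>
  obtain u v u' v' where uv: "u \<in> e" "u' \<in> e" "v \<in> f" "v' \<in> f"
    and o: "place r u < place r v" "place r v < place r u'" "place r u' < place r v'"
    using il unfolding interleaved_def by blast
  show ?thesis
    using E(1) r
  proof (cases rule: wb_edge_cases)
    case (row w l)
    then show ?thesis using row_gap[of u w l u'] uv o by metis
  next
    case e: (closing w)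
    show ?thesis
      using E(2) r
    proof (cases rule: wb_edge_cases)
      case (row w l)
      then show ?thesis using row_gap[of v w l v'] uv o by metis
    next
      case (closing w2)
      with uv obtain l where "v = (w2, l)" "l = 0 \<or> l = r - 1"
        by auto
      then show ?thesis
        using closing_gap[of u w r u' w2 l] uv o e closing r by auto
    next
      case (cross k w2)
      then show ?thesis
        using closing_crosses[of u w r u' v k w2 False] uv o e page by (simp add: Y_def)
    qed
  next
    case e: (cross j w)
    show ?thesis
      using E(2) r
    proof (cases rule: wb_edge_cases)
      case (row w l)
      then show ?thesis using row_gap[of v w l v'] uv o by metis
    next
      case (closing w2)
      then show ?thesis
        using closing_crosses[of v w2 r v' u' j w False] uv o e page by (simp add: Y_def)
    next
      case f: (cross k w2)
      have par: "even j = even k"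
        using page e f by simp
      consider "j < k" | "j = k" | "k < j" by linarith
      then show ?thesis
      proof cases
        case 1
        then show ?thesis
          using cross_crosses[of u r j w False u' v k w2 False] uv o e f par by (simp add: Y_def)
      next
        case 2
        then show ?thesis
          using same_bit_crosses[of r k w False w2 False] il e f by (auto simp: Y_def)
      next
        case 3
        then show ?thesis
          using cross_crosses[of v r k w2 False v' u' j w False] uv o e f par by (simp add: Y_def)
      qed
    qed
  qed
qed

section \<open>Counting the crossing pairs\<close>

text \<open>\<open>A\<close> and its image are disjoint subsets of \<open>T\<close> of equal size.
  In the applications the injection flips bits.\<close>

lemma card_le_half:
  assumes "finite T" "A \<subseteq> T" "inj_on \<phi> T" "\<And>a. a \<in> A \<Longrightarrow> \<phi> a \<in> T - A"
  shows "2 * card A \<le> card T"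
proof -
  have "2 * card A = card A + card (\<phi> ` A)"
    using assms by (simp add: card_image inj_on_subset)
  also have "\<dots> = card (A \<union> \<phi> ` A)"
    using assms by (intro card_Un_disjoint[symmetric]) (auto intro: finite_subset)
  also have "\<dots> \<le> card T"
    using assms by (intro card_mono) auto
  finally show ?thesis .
qed

lemma card_closing_pairs: "finite (closing_pairs r)" "card (closing_pairs r) \<le> 2 ^ r * (r - 2)"
proof -
  show "finite (closing_pairs r)"
    by (simp add: closing_pairs_def)
  have "card (closing_pairs r) \<le> card (words r \<times> {1..<r - 1})"
    unfolding closing_pairs_def by (rule card_image_le) simp
  then show "card (closing_pairs r) \<le> 2 ^ r * (r - 2)"
    by (simp add: card_cartesian_product card_words numeral_2_eq_2)
qed

lemma card_same_bit_pairs: "finite (same_bit_pairs r)" "2 * card (same_bit_pairs r) \<le> r * 2 ^ r"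
proof -
  let ?W = "\<lambda>k. {w \<in> words r. even (gray (drop k w))}"
  show "finite (same_bit_pairs r)"
    by (simp add: same_bit_pairs_def)
  \<comment> \<open>Flipping bit \<open>k\<close> moves a lower half block to the upper one.\<close>
  have "2 * card (?W k) \<le> 2 ^ r" if "k < r" for k
    unfolding card_words[symmetric]
  proof (rule card_le_half)
    show "inj_on (flip k) (words r)"
      by (metis flip_flip inj_onI)
    show "flip k w \<in> words r - ?W k" if "w \<in> ?W k" for w
      using that \<open>k < r\<close> gray_less_flip(3)[of k w] by (simp add: words_def)
  qed auto
  then have "(\<Sum>k<r. 2 * card (?W k)) \<le> (\<Sum>k<r. 2 ^ r)"
    by (intro sum_mono) simp
  moreover have "card (same_bit_pairs r) \<le> card (SIGMA k:{..<r}. ?W k)"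
    unfolding same_bit_pairs_def by (rule card_image_le) simp
  then have "card (same_bit_pairs r) \<le> (\<Sum>k<r. card (?W k))"
    by (simp add: card_SigmaI)
  ultimately show "2 * card (same_bit_pairs r) \<le> r * 2 ^ r"
    by (simp add: sum_distrib_left[symmetric])
qed

text \<open>Flipping bit \<open>j - 1\<close> reflects each block of \<open>2 ^ j\<close> rows and so reverses the comparison of
  the two places, hence at most half of all candidates are covered.\<close>

lemma card_cover:
  assumes "0 < j" "j < k" "k < r"
  shows "finite (cover r j k)" "card (cover r j k) \<le> 2 ^ r * 2 ^ (j + 1)"
proof -
  define T where "T = {(w :: bool list, s :: bool, v :: bool list, t :: bool).
    length w = r \<and> length v = r \<and> drop j w = drop j v}"
  define D where "D = words r \<times> (UNIV :: bool set) \<times> words j \<times> (UNIV :: bool set)"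
  define \<phi> where "\<phi> = (\<lambda>(w, s :: bool, v, t :: bool). (flip (j - 1) w, s, flip (j - 1) v, t))"
  \<comment> \<open>As \<open>v\<close> agrees with \<open>w\<close> from bit \<open>j\<close> on,
    it is determined by \<open>w\<close> and its own first \<open>j\<close> bits.\<close>
  have sub: "T \<subseteq> (\<lambda>(w, s, u, t). (w, s, u @ drop j w, t)) ` D"
  proof
    fix x assume "x \<in> T"
    then obtain w s v t where x: "x = (w, s, v, t)" "length w = r" "length v = r" "drop j w = drop j v"
      by (auto simp: T_def)
    then show "x \<in> (\<lambda>(w, s, u, t). (w, s, u @ drop j w, t)) ` D"
      using assms by (intro image_eqI[of _ _ "(w, s, take j v, t)"]) (auto simp: D_def words_def)
  qed
  have "finite D"
    by (simp add: D_def)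
  then have T: "finite T" "card T \<le> card D"
    using sub by (auto intro: finite_subset surj_card_le)
  have cT: "cover r j k \<subseteq> T"
    by (auto simp: cover_def T_def)
  then show "finite (cover r j k)"
    using T finite_subset by blast
  have "2 * card (cover r j k) \<le> card T"
  proof (rule card_le_half[OF T(1) cT])
    show "inj_on \<phi> T"
      by (auto simp: inj_on_def \<phi>_def) (metis flip_flip)+
    fix x assume x: "x \<in> cover r j k"
    then obtain w s v t where w: "x = (w, s, v, t)" "length w = r" "length v = r" "drop j w = drop j v"
      by (auto simp: cover_def)
    then have "\<phi> x \<in> T"
      using assms by (auto simp: T_def \<phi>_def)
    moreover have "\<phi> x \<notin> cover r j k"
    proof -
      let ?l = "cross_level r j s" and ?m = "cross_level r k t"
      \<comment> \<open>Both rows lie in the same block of \<open>2 ^ j\<close> rows, so both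
        reflections have the same centre. The bits from \<open>j\<close> on are kept, and with them
        the parity that decides the direction of the comparison.\<close>
      have "place r (flip (j - 1) w, ?l) + place r (w, ?l) = place r (flip (j - 1) v, ?m) + place r (v, ?m)"
        using place_flip[of "j - 1" w ?l r] place_flip[of "j - 1" v ?m r] w assms
        by (simp add: less_imp_diff_less)
      then show ?thesis
        using x w assms by (auto simp: cover_def \<phi>_def split: if_splits)
    qed
    ultimately show "\<phi> x \<in> T - cover r j k"
      by simp
  qed
  also note T(2)
  also have "card D = 2 * (2 ^ r * 2 ^ (j + 1))"
    by (simp add: D_def card_cartesian_product card_words)
  finally show "card (cover r j k) \<le> 2 ^ r * 2 ^ (j + 1)"
    by (simp add: ac_simps)
qed

text \<open>Since levels decrease towards the middle of a pair of adjacent rows, the short arcs of bit 0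
  cover no vertices except the two at level 0.\<close>

lemma card_cover_0:
  assumes "2 \<le> k" "k < r"
  shows "finite (cover r 0 k)" "card (cover r 0 k) \<le> (if k = r - 1 then 2 ^ r else 0)"
proof -
  let ?C = "if k = r - 1 then (\<lambda>w. (w, True, w, True)) ` words r else {}"
  have sub: "cover r 0 k \<subseteq> ?C"
  proof
    fix x assume "x \<in> cover r 0 k"
    then obtain w s t where x: "x = (w, s, w, t)" "length w = r"
      and "cross_level r k t < cross_level r 0 s"
      using assms cross_level_less[of 0 r s] cross_level_less[of k r t]
      by (auto simp: cover_def place_def split: if_splits)
    \<comment> \<open>The bit-0 ends have levels \<open>0\<close> and \<open>1\<close>, so the
      bit-\<open>k\<close> end has level \<open>0\<close>, which it reaches only by wrapping around
      from \<open>r - 1\<close>.\<close>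
    then have "s" "t" "k = r - 1"
      using assms by (cases "Suc k = r"; cases s; cases t; simp add: cross_level_def)+
    with x show "x \<in> ?C"
      by (simp add: words_def)
  qed
  have fin: "finite ?C"
    by simp
  show "finite (cover r 0 k)"
    by (rule finite_subset[OF sub fin])
  have "card ?C \<le> (if k = r - 1 then 2 ^ r else 0)"
    using card_image_le[OF finite_words, of "\<lambda>w. (w, True, w, True)" r] by (simp add: card_words)
  with card_mono[OF fin sub] show "card (cover r 0 k) \<le> (if k = r - 1 then 2 ^ r else 0)"
    by (rule le_trans)
qed

text \<open>The bound, in units of \<open>2 ^ r\<close>, on the crossings of bit-\<open>k\<close>
  arcs with arcs for smaller positive bits.\<close>

definition weight :: "nat \<Rightarrow> nat" where
  "weight k = (\<Sum>j | 0 < j \<and> j < k \<and> even j = even k. 2 ^ (j + 1))"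

lemma card_cross_pairs:
  assumes "r > 0"
  shows "finite (cross_pairs r)" "card (cross_pairs r) \<le> 2 ^ r * (1 + (\<Sum>k<r. weight k))"
proof -
  let ?J = "\<lambda>k. {j. j < k \<and> even j = even k}" and ?J' = "\<lambda>k. {j. 0 < j \<and> j < k \<and> even j = even k}"
  let ?K = "SIGMA k:{..<r}. ?J k"
  have fin: "finite (cover r j k)" if "k < r" "j < k" "even j = even k" for j k
  proof (cases "j = 0")
    case True
    with that have "2 \<le> k" by (auto elim!: evenE)
    with True that card_cover_0 show ?thesis by simp
  qed (use that card_cover in simp)
  have finS: "finite (SIGMA (k, j):?K. cover r j k)"
    by (intro finite_SigmaI) (auto intro: fin)
  then show "finite (cross_pairs r)"
    by (simp add: cross_pairs_def)
  have row: "(\<Sum>j\<in>?J k. card (cover r j k)) \<le> (if k = r - 1 then 2 ^ r else 0) + 2 ^ r * weight k"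
    if "k < r" for k
  proof -
    \<comment> \<open>Bit \<open>0\<close> is split off. It occurs for even \<open>k\<close> only
      and is charged to \<open>k = r - 1\<close>, which gives the summand \<open>1\<close> in the
      final bound.\<close>
    have "(\<Sum>j\<in>?J k. card (cover r j k))
      \<le> (\<Sum>j\<in>(if even k \<and> 0 < k then {0} else {}) \<union> ?J' k. card (cover r j k))"
      by (intro sum_mono2) (auto intro!: Nat.gr0I)
    also have "\<dots> = (\<Sum>j\<in>(if even k \<and> 0 < k then {0} else {}). card (cover r j k))
        + (\<Sum>j\<in>?J' k. card (cover r j k))"
      by (intro sum.union_disjoint) auto
    also have "\<dots> \<le> (if k = r - 1 then 2 ^ r else 0) + (\<Sum>j\<in>?J' k. 2 ^ r * 2 ^ (j + 1))"
    proof (intro add_mono sum_mono)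
      have "2 \<le> k" if "even k" "0 < k"
        using that by presburger
      then show "(\<Sum>j\<in>(if even k \<and> 0 < k then {0} else {}). card (cover r j k))
          \<le> (if k = r - 1 then 2 ^ r else 0)"
        using card_cover_0(2)[of k r] \<open>k < r\<close> by auto
    qed (use card_cover(2) \<open>k < r\<close> in auto)
    finally show ?thesis
      by (simp add: weight_def sum_distrib_left)
  qed
  have "card (cross_pairs r) \<le> card (SIGMA (k, j):?K. cover r j k)"
    unfolding cross_pairs_def by (rule card_image_le[OF finS])
  also have "\<dots> = (\<Sum>(k, j)\<in>?K. card (cover r j k))"
    by (subst card_SigmaI) (auto intro: fin simp: case_prod_unfold)
  also have "\<dots> = (\<Sum>k<r. \<Sum>j\<in>?J k. card (cover r j k))"
    by (rule sum.Sigma[symmetric]) auto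
  also have "\<dots> \<le> (\<Sum>k<r. (if k = r - 1 then 2 ^ r else 0) + 2 ^ r * weight k)"
    using row by (intro sum_mono) simp
  also have "\<dots> = 2 ^ r * (1 + (\<Sum>k<r. weight k))"
    using assms by (simp add: sum.distrib sum_distrib_left)
  finally show "card (cross_pairs r) \<le> 2 ^ r * (1 + (\<Sum>k<r. weight k))" .
qed

section \<open>Summing the weights\<close>

lemma weight_0_1: "weight 0 = 0" "weight (Suc 0) = 0"
proof -
  have "{j. 0 < j \<and> j < Suc 0 \<and> odd j} = {}"
    by auto
  then show "weight 0 = 0" "weight (Suc 0) = 0"
    by (simp_all add: weight_def)
qed

lemma weight_step: "weight (Suc (Suc k)) = weight k + (if k = 0 then 0 else 2 ^ (k + 1))"
proof (cases "k = 0")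
  case True
  have "{j. 0 < j \<and> j < Suc (Suc 0) \<and> even j} = {}"
    by (auto simp: less_Suc_eq)
  with True show ?thesis by (simp add: weight_def)
next
  case False
  have "{j. 0 < j \<and> j < Suc (Suc k) \<and> even j = even k} = insert k {j. 0 < j \<and> j < k \<and> even j = even k}"
    using False by (auto simp: less_Suc_eq)
  with False show ?thesis by (simp add: weight_def)
qed

text \<open>A geometric sum of ratio \<open>4\<close> stays below \<open>4 / 3\<close> of its
  largest term, here \<open>2 ^ (k - 1)\<close>.\<close>

lemma weight_le: "3 * weight k \<le> 2 ^ (k + 1)"
  by (induction k rule: induct_nat_012) (simp_all add: weight_0_1 weight_step)

text \<open>This is the final estimate after multiplication by \<open>8\<close> and division by
  \<open>2 ^ r\<close>. The induction starts at \<open>6\<close> because the inequality fails at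
  \<open>5\<close>; each step needs \<open>8 * weight r + 36 \<le> 7 * 2 ^ r\<close>.\<close>

lemma sum_weight_le:
  assumes "r \<ge> 6"
  shows "8 * (\<Sum>k<r. weight k) + 36 * r \<le> 7 * 2 ^ r + 40"
  using assms
proof (induction r rule: dec_induct)
  case base
  show ?case
    by (simp add: eval_nat_numeral weight_0_1 weight_step)
next
  case (step r)
  have "(2::nat) ^ 6 \<le> 2 ^ r"
    using step by (intro power_increasing) auto
  then show ?case
    using step weight_le[of r] by simp
qed

theorem theorem3p14:
  fixes r :: nat
  assumes "r \<ge> 6"
  shows "real (crossing_number (wb_vertices r) (wb_edges r))
           \<le> 7 / 8 * 4 ^ r - (3 * real r - 4) * 2 ^ r"
proof -
  define S where "S = (\<Sum>k<r. weight k)"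
  let ?Y = "closing_pairs r \<union> same_bit_pairs r \<union> cross_pairs r"
  have "crossing_number (wb_vertices r) (wb_edges r) \<le> card ?Y"
  proof (rule crossing_number_two_page)
    show "inj_on (place r) (wb_vertices r)"
      using inj_on_place wb_vertices_eq[of r] assms by simp
    show "e \<subseteq> wb_vertices r \<and> card e = 2" if "e \<in> wb_edges r" for e
      using wb_edges_simple[of r e] that assms by simp
    show "finite ?Y"
      using assms by (simp add: card_closing_pairs card_same_bit_pairs card_cross_pairs)
    show "(e, f) \<in> ?Y \<or> (f, e) \<in> ?Y"
      if "e \<in> wb_edges r" "f \<in> wb_edges r" "upper e = upper f" "interleaved (place r) e f" for e f
      using interleaved_pairs[of r e f] that assms by simp
  qed
  also have "card ?Y \<le> card (closing_pairs r) + card (same_bit_pairs r) + card (cross_pairs r)"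
    by (meson add_mono card_Un_le le_trans order_refl)
  \<comment> \<open>The factor \<open>8\<close> clears the denominators of \<open>7 / 8\<close> and
    of the half in the same-bit count.\<close>
  finally have "8 * crossing_number (wb_vertices r) (wb_edges r)
      \<le> 8 * (2 ^ r * (r - 2)) + 4 * (r * 2 ^ r) + 8 * (2 ^ r * (1 + S))"
    using card_closing_pairs(2)[of r] card_same_bit_pairs(2)[of r] card_cross_pairs(2)[of r] assms
    unfolding S_def by linarith
  also have "\<dots> = 2 ^ r * (8 * (r - 2) + 4 * r + 8 + 8 * S)"
    by (simp add: algebra_simps)
  finally have "real (8 * crossing_number (wb_vertices r) (wb_edges r))
      \<le> real (2 ^ r * (8 * (r - 2) + 4 * r + 8 + 8 * S))"
    by (simp only: of_nat_le_iff)
  also have "\<dots> = 2 ^ r * (8 * (real r - 2) + 4 * real r + 8 + 8 * real S)"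
    using assms by (simp add: of_nat_diff)
  also have "\<dots> \<le> 2 ^ r * (7 * 2 ^ r - 24 * real r + 32)"
  proof (intro mult_left_mono)
    have "real (8 * S + 36 * r) \<le> real (7 * 2 ^ r + 40)"
      using sum_weight_le[OF assms] unfolding S_def by (simp only: of_nat_le_iff)
    then show "8 * (real r - 2) + 4 * real r + 8 + 8 * real S \<le> 7 * 2 ^ r - 24 * real r + 32"
      by simp
  qed simp
  also have "\<dots> = 8 * (7 / 8 * 4 ^ r - (3 * real r - 4) * 2 ^ r)"
    by (simp add: algebra_simps power_mult_distrib[symmetric])
  finally show ?thesis
    by simp
qed

end
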